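(* Suppose that there exist a constant $c>0$ and a family $(X_n)_{n\in\mathbb{N}}=\mathrm{Sch}(G_n,\Omega_n,S_n)$ of Schreier graphs, where for each $n$ the finite group $G_n$ acts transitively on the finite set $\Omega_n$ with $|\Omega_n|\geq2$ and $S_n\subseteq G_n$, such that the minimal dimension of a non-trivial irreducible component of the permutation representation for the action of $G_n$ on $\Omega_n$ is at least $|G_n|^c$. Then for every $n\in\mathbb{N}$, for every probability distribution $\mu_n$ on $G_n$ and for every function $f_n:\Omega_n\to\mathbb{R}$ that satisfies $\sum_{x\in\Omega_n}f_n(x)=0$, $$\|\mu_n\ast_c f_n\|^2\leq |G_n|^{1-c}\cdot\|\mu_n\|^2\cdot\|f_n\|^2.$$
   Context: Group actions are written on the left. For a group $G$ acting transitively on a set $\Omega$ and $S\subseteq G$, the Schreier graph $\mathrm{Sch}(G,\Omega,S)$ is the directed graph whose vertices are the elements of $\Omega$ and whose edges are $(\omega,s\omega)$ for every $\omega\in\Omega$ and every $s\in S$. The permutation representation is the complex representation of $G$ on the vector space with basis $\Omega$ extending the action. A probability distribution over a finite set $\Lambda$ is a function $Z:\Lambda\to\mathbb{R}$ with $\sum_{\lambda\in\Lambda}Z(\lambda)=1$. The norm of $Z:\Lambda\to\mathbb{R}$ is $\|Z\|=\left(\sum_{\lambda\in\Lambda}Z(\lambda)^2\right)^{1/2}$. For $X:G\to\mathbb{R}$ and $Y:\Omega\to\mathbb{R}$, the convolution $X\ast_c Y:\Omega\to\mathbb{R}$ is $(X\ast_c Y)(\omega)=\sum_{g\in G}X(g)Y(g^{-1}\omega)$.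 *)

theory Defs
  imports
    "HOL-Analysis.L2_Norm"
    "HOL-Algebra.Group_Action"
    "HOL-Library.Function_Algebras"
    "Graph_Theory.Pair_Digraph"
begin

text \<open>
  Actions are those of \<^theory>\<open>HOL-Algebra.Group_Action\<close>: \<open>\<phi> g x\<close> is the point \<open>g x\<close>, and
  since multiplication in \<open>BijGroup \<Omega>\<close> is composition, actions are on the left.
\<close>

definition Sch :: "('g, 'm) monoid_scheme \<Rightarrow> 'w set \<Rightarrow> ('g \<Rightarrow> 'w \<Rightarrow> 'w) \<Rightarrow> 'g set \<Rightarrow> 'w pair_pre_digraph"
  where "Sch G \<Omega> \<phi> S = \<lparr> pverts = \<Omega>, parcs = {(x, \<phi> s x) | x s. x \<in> \<Omega> \<and> s \<in> S} \<rparr>"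

text \<open>
  Vectors are functions \<open>v :: 'w \<Rightarrow> complex\<close> with the pointwise addition of
  \<^theory>\<open>HOL-Library.Function_Algebras\<close>; the function \<open>v\<close> supported on the finite set \<open>\<Omega>\<close> stands
  for the formal combination of the points \<open>x \<in> \<Omega>\<close> with coefficients \<open>v x\<close>.
\<close>

definition cscale :: "complex \<Rightarrow> ('w \<Rightarrow> complex) \<Rightarrow> 'w \<Rightarrow> complex"
  where "cscale a v = (\<lambda>x. a * v x)"

global_interpretation cfun: vector_space cscale
  by unfold_locales (auto simp: cscale_def fun_eq_iff algebra_simps)

definition basis_vec :: "'w \<Rightarrow> 'w \<Rightarrow> complex"
  where "basis_vec x = (\<lambda>y. if y = x then 1 else 0)"

definition perm_space :: "'w set \<Rightarrow> ('w \<Rightarrow> complex) set"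
  where "perm_space \<Omega> = cfun.span (basis_vec ` \<Omega>)"

definition perm_rep :: "'w set \<Rightarrow> ('g \<Rightarrow> 'w \<Rightarrow> 'w) \<Rightarrow> 'g \<Rightarrow> ('w \<Rightarrow> complex) \<Rightarrow> 'w \<Rightarrow> complex"
  where "perm_rep \<Omega> \<phi> g v = (\<Sum>x\<in>\<Omega>. cscale (v x) (basis_vec (\<phi> g x)))"

definition subrepresentation ::
  "('g, 'm) monoid_scheme \<Rightarrow> ('g \<Rightarrow> ('w \<Rightarrow> complex) \<Rightarrow> 'w \<Rightarrow> complex) \<Rightarrow>
   ('w \<Rightarrow> complex) set \<Rightarrow> ('w \<Rightarrow> complex) set \<Rightarrow> bool"
  where "subrepresentation G \<rho> V W \<longleftrightarrow>
    cfun.subspace W \<and> W \<subseteq> V \<and> (\<forall>g\<in>carrier G. \<rho> g ` W \<subseteq> W)"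

definition irreducible_component ::
  "('g, 'm) monoid_scheme \<Rightarrow> ('g \<Rightarrow> ('w \<Rightarrow> complex) \<Rightarrow> 'w \<Rightarrow> complex) \<Rightarrow>
   ('w \<Rightarrow> complex) set \<Rightarrow> ('w \<Rightarrow> complex) set \<Rightarrow> bool"
  where "irreducible_component G \<rho> V W \<longleftrightarrow>
    subrepresentation G \<rho> V W \<and> W \<noteq> {0} \<and>
    (\<forall>U. subrepresentation G \<rho> W U \<longrightarrow> U = {0} \<or> U = W)"

definition trivial_on ::
  "('g, 'm) monoid_scheme \<Rightarrow> ('g \<Rightarrow> ('w \<Rightarrow> complex) \<Rightarrow> 'w \<Rightarrow> complex) \<Rightarrow> ('w \<Rightarrow> complex) set \<Rightarrow> bool"
  where "trivial_on G \<rho> W \<longleftrightarrow> (\<forall>g\<in>carrier G. \<forall>w\<in>W. \<rho> g w = w)"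

text \<open>
  For a transitive action on a finite set with at least two points a non-trivial irreducible
  component exists (complete reducibility), so the minimum is then attained.
\<close>

definition min_nontrivial_dim :: "('g, 'm) monoid_scheme \<Rightarrow> 'w set \<Rightarrow> ('g \<Rightarrow> 'w \<Rightarrow> 'w) \<Rightarrow> nat"
  where "min_nontrivial_dim G \<Omega> \<phi> = (LEAST d. \<exists>W.
    irreducible_component G (perm_rep \<Omega> \<phi>) (perm_space \<Omega>) W \<and>
    \<not> trivial_on G (perm_rep \<Omega> \<phi>) W \<and> d = cfun.dim W)"

text \<open>The source requires total mass 1 only: the values may be negative.\<close>

definition prob_distribution :: "'a set \<Rightarrow> ('a \<Rightarrow> real) \<Rightarrow> bool"
  where "prob_distribution \<Lambda> Z \<longleftrightarrow> (\<Sum>x\<in>\<Lambda>. Z x) = 1"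

definition convolution ::
  "('g, 'm) monoid_scheme \<Rightarrow> ('g \<Rightarrow> 'w \<Rightarrow> 'w) \<Rightarrow> ('g \<Rightarrow> real) \<Rightarrow> ('w \<Rightarrow> real) \<Rightarrow> 'w \<Rightarrow> real"
  where "convolution G \<phi> X Y = (\<lambda>x. \<Sum>g\<in>carrier G. X g * Y (\<phi> (inv\<^bsub>G\<^esub> g) x))"

end

theory Submission
  imports Defs "HOL-Analysis.Convex" "HOL-Analysis.Function_Topology" "HOL-Analysis.Topology_Euclidean_Space"
begin

text \<open>
  For a fixed vector \<open>u\<close>, consider the quadratic form \<open>Q w\<close>, the sum over \<open>g\<close> of
  \<open>|\<langle>g w, u\<rangle>|\<^sup>2\<close>, on the vectors of mean zero. Let \<open>l\<close> be its maximum on the unit sphere. The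
  vectors with \<open>Q w = l * \<parallel>w\<parallel>\<^sup>2\<close> form the null space of a positive semidefinite form, hence an
  invariant subspace; it contains an irreducible component, which is non-trivial because by
  transitivity only \<open>0\<close> is both invariant and of mean zero. Summing \<open>Q\<close> over an orthonormal
  family of \<open>D\<close> vectors in that component, \<open>D\<close> being the minimal dimension, and applying Bessel's
  inequality to each \<open>g\<inverse> u\<close> gives \<open>D * l \<le> |G| * \<parallel>u\<parallel>\<^sup>2\<close>. Taking \<open>u\<close> to be the convolution of
  \<open>\<mu>\<close> and \<open>f\<close>, the number \<open>\<parallel>u\<parallel>\<^sup>2\<close> is the sum of \<open>\<mu> g * \<langle>g f, u\<rangle>\<close> over \<open>g\<close>, so the theorem
  follows by the Cauchy-Schwarz inequality. This avoids decomposing the representation.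
\<close>

section \<open>The standard Hermitian form on functions\<close>

definition herm :: "'w set \<Rightarrow> ('w \<Rightarrow> complex) \<Rightarrow> ('w \<Rightarrow> complex) \<Rightarrow> complex"
  where "herm A v w = (\<Sum>x\<in>A. v x * cnj (w x))"

definition norm_sq :: "'w set \<Rightarrow> ('w \<Rightarrow> complex) \<Rightarrow> real"
  where "norm_sq A v = (\<Sum>x\<in>A. (cmod (v x))\<^sup>2)"

lemma sum_fun_eval: "(\<Sum>i\<in>I. F i) x = (\<Sum>i\<in>I. (F i x :: complex))"
  by (induction I rule: infinite_finite_induct) auto

lemma herm_add_left: "herm A (v + w) u = herm A v u + herm A w u"
  by (simp add: herm_def sum.distrib algebra_simps)

lemma herm_diff_left: "herm A (v - w) u = herm A v u - herm A w u"
  by (simp add: herm_def sum_subtractf algebra_simps)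

lemma herm_diff_right: "herm A u (v - w) = herm A u v - herm A u w"
  by (simp add: herm_def sum_subtractf algebra_simps)

lemma herm_scale_left: "herm A (cscale a v) u = a * herm A v u"
  by (simp add: herm_def cscale_def sum_distrib_left algebra_simps)

lemma herm_commute: "herm A w v = cnj (herm A v w)"
  by (simp add: herm_def mult.commute)

lemma herm_sum_left: "herm A (\<Sum>i\<in>I. F i) u = (\<Sum>i\<in>I. herm A (F i) u)"
  by (simp add: herm_def sum_fun_eval sum_distrib_right sum.swap[of _ A I])

lemma herm_self: "herm A v v = of_real (norm_sq A v)"
  unfolding herm_def norm_sq_def of_real_sum
  by (intro sum.cong refl) (metis complex_norm_square)

lemma norm_sq_nonneg: "norm_sq A v \<ge> 0"
  by (simp add: norm_sq_def sum_nonneg)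

lemma norm_sq_scale: "norm_sq A (cscale a v) = (cmod a)\<^sup>2 * norm_sq A v"
  by (simp add: norm_sq_def cscale_def norm_mult power_mult_distrib sum_distrib_left)

text \<open>Summed over coordinates or over the group, this identity passes to
  \<open>norm_sq\<close> and \<open>coeff_sum\<close>; comparing the two is what makes the set of
  extremal vectors closed under addition.\<close>

lemma cmod_parallelogram:
  "(cmod (a + b))\<^sup>2 + (cmod (a - b))\<^sup>2 = 2 * (cmod a)\<^sup>2 + 2 * (cmod b)\<^sup>2"
  unfolding cmod_power2 by (simp add: power2_eq_square algebra_simps)

lemma norm_sq_parallelogram:
  "norm_sq A (v + w) + norm_sq A (v - w) = 2 * norm_sq A v + 2 * norm_sq A w"
  by (simp add: norm_sq_def sum_distrib_left cmod_parallelogram flip: sum.distrib)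

section \<open>Orthonormal families and Bessel's inequality\<close>

definition orthonormal :: "'w set \<Rightarrow> ('w \<Rightarrow> complex) set \<Rightarrow> bool"
  where "orthonormal A B \<longleftrightarrow> (\<forall>b\<in>B. \<forall>b'\<in>B. herm A b b' = (if b = b' then 1 else 0))"

text \<open>For finite orthonormal \<open>B\<close> this is the orthogonal projection onto the span
  of \<open>B\<close>.\<close>

definition proj :: "'w set \<Rightarrow> ('w \<Rightarrow> complex) set \<Rightarrow> ('w \<Rightarrow> complex) \<Rightarrow> 'w \<Rightarrow> complex"
  where "proj A B v = (\<Sum>b\<in>B. cscale (herm A v b) b)"

lemma herm_proj:
  assumes "finite B" "orthonormal A B" "b \<in> B"
  shows "herm A (proj A B v) b = herm A v b"
proof -
  have "herm A (proj A B v) b = (\<Sum>b'\<in>B. herm A v b' * (if b' = b then 1 else 0))"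
    unfolding proj_def herm_sum_left herm_scale_left
    using assms by (intro sum.cong) (auto simp: orthonormal_def)
  also have "\<dots> = herm A v b"
    using assms by (simp add: sum.delta if_distrib cong: if_cong)
  finally show ?thesis .
qed

lemma herm_proj_left: "herm A (proj A B v) w = (\<Sum>b\<in>B. herm A v b * cnj (herm A w b))"
  unfolding proj_def herm_sum_left herm_scale_left
  by (intro sum.cong refl) (metis herm_commute)

text \<open>The difference of the two sides is the squared norm of \<open>v - proj A B v\<close>,
  because \<open>v\<close> and its projection have the same inner product with the
  projection.\<close>

lemma bessel:
  assumes "finite B" "orthonormal A B"
  shows "(\<Sum>b\<in>B. (cmod (herm A v b))\<^sup>2) \<le> norm_sq A v"
proof -
  let ?p = "proj A B v"
  have pv: "herm A ?p v = of_real (\<Sum>b\<in>B. (cmod (herm A v b))\<^sup>2)"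
    unfolding herm_proj_left of_real_sum
    by (intro sum.cong refl) (metis complex_norm_square)
  have "herm A ?p ?p = (\<Sum>b\<in>B. herm A v b * cnj (herm A ?p b))"
    by (rule herm_proj_left)
  also have "\<dots> = herm A ?p v"
    unfolding herm_proj_left[of A B v v] by (intro sum.cong refl) (simp only: herm_proj[OF assms])
  finally have pp: "herm A ?p ?p = herm A ?p v" .
  have vp: "herm A v ?p = herm A ?p v"
    by (metis pv herm_commute complex_cnj_complex_of_real)
  have "complex_of_real (norm_sq A (v - ?p)) = herm A v v - herm A ?p v"
    by (simp add: herm_diff_left herm_diff_right pp vp flip: herm_self)
  also have "\<dots> = of_real (norm_sq A v - (\<Sum>b\<in>B. (cmod (herm A v b))\<^sup>2))"
    by (simp add: herm_self pv)
  finally have "norm_sq A (v - ?p) = norm_sq A v - (\<Sum>b\<in>B. (cmod (herm A v b))\<^sup>2)"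
    using of_real_eq_iff by blast
  then show ?thesis
    using norm_sq_nonneg[of A "v - ?p"] by linarith
qed

section \<open>Linear algebra and compactness in the permutation space\<close>

lemma mem_perm_space_iff:
  assumes "finite A"
  shows "v \<in> perm_space A \<longleftrightarrow> (\<forall>x. x \<notin> A \<longrightarrow> v x = 0)"
proof
  assume "v \<in> perm_space A"
  then show "\<forall>x. x \<notin> A \<longrightarrow> v x = 0"
    unfolding perm_space_def
    by (induction rule: cfun.span_induct_alt) (auto simp: cscale_def basis_vec_def split: if_splits)
next
  assume v: "\<forall>x. x \<notin> A \<longrightarrow> v x = 0"
  have "v = (\<Sum>x\<in>A. cscale (v x) (basis_vec x))"
  proof
    fix y
    have "(\<Sum>x\<in>A. cscale (v x) (basis_vec x)) y = (\<Sum>x\<in>A. if y = x then v x else 0)"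
      unfolding sum_fun_eval by (intro sum.cong) (auto simp: cscale_def basis_vec_def)
    then show "v y = (\<Sum>x\<in>A. cscale (v x) (basis_vec x)) y"
      using v assms by (auto simp: sum.delta)
  qed
  also have "\<dots> \<in> perm_space A"
    unfolding perm_space_def by (intro cfun.span_sum cfun.span_scale cfun.span_base imageI)
  finally show "v \<in> perm_space A" .
qed

lemma subspace_perm_space: "cfun.subspace (perm_space A)"
  unfolding perm_space_def by (rule cfun.subspace_span)

lemma norm_sq_eq_0_iff:
  assumes "finite A" "v \<in> perm_space A"
  shows "norm_sq A v = 0 \<longleftrightarrow> v = 0"
proof
  assume "norm_sq A v = 0"
  then have "\<forall>x\<in>A. v x = 0"
    using assms by (simp add: norm_sq_def sum_nonneg_eq_0_iff)
  then show "v = 0"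
    using assms by (force simp: mem_perm_space_iff fun_eq_iff)
qed (simp add: norm_sq_def)

lemma independent_perm_space_finite:
  assumes "finite A" "cfun.independent B" "B \<subseteq> perm_space A"
  shows "finite B"
  using cfun.independent_span_bound[of "basis_vec ` A" B] assms by (simp add: perm_space_def)

text \<open>A basis of \<open>U\<close> extends to a basis of \<open>W\<close>, and the dimension
  bound leaves no room for new vectors. Finiteness of the bases comes from the finite spanning set
  of \<open>perm_space A\<close>, as the space of all functions may have infinite dimension.\<close>

lemma subspace_eq_of_dim_le:
  assumes A: "finite A" and W: "W \<subseteq> perm_space A" and U: "cfun.subspace U" "U \<subseteq> W"
    and dim: "cfun.dim W \<le> cfun.dim U"
  shows "U = W"
proof -
  obtain B where B: "B \<subseteq> U" "cfun.independent B" "U \<subseteq> cfun.span B" "card B = cfun.dim U"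
    using cfun.basis_exists .
  obtain C where C: "B \<subseteq> C" "C \<subseteq> W" "cfun.independent C" "W \<subseteq> cfun.span C"
    using cfun.maximal_independent_subset_extend[of B W] B U by blast
  have "finite C"
    using independent_perm_space_finite[OF A C(3)] C(2) W by blast
  moreover have "card C = cfun.dim W"
    using cfun.dim_unique[OF C(2,4,3)] by simp
  ultimately have "B = C"
    using C(1) B(4) dim by (metis card_seteq)
  then have "W \<subseteq> U"
    using C(4) cfun.span_minimal[OF B(1) U(1)] by blast
  with U show ?thesis by blast
qed

text \<open>Gram-Schmidt, stopped after \<open>n\<close> vectors. The size is left free because the
  family used later has the minimal dimension as its size, which may be less than the dimension of
  the component containing it.\<close>

lemma orthonormal_subset_exists:
  assumes A: "finite A" and W: "cfun.subspace W" "W \<subseteq> perm_space A" and "n \<le> cfun.dim W"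
  shows "\<exists>B\<subseteq>W. finite B \<and> card B = n \<and> orthonormal A B"
  using assms(4)
proof (induction n)
  case 0
  show ?case
    by (rule exI[of _ "{}"]) (simp add: orthonormal_def)
next
  case (Suc n)
  then obtain B where B: "B \<subseteq> W" "finite B" "card B = n" "orthonormal A B" by auto
  \<comment> \<open>Otherwise \<open>W\<close> would have dimension at most \<open>n\<close>,
    against \<open>Suc n \<le> cfun.dim W\<close>.\<close>
  have "\<not> W \<subseteq> cfun.span B"
    using cfun.dim_le_card[OF _ B(2), of W] Suc.prems B(3) by auto
  then obtain x where x: "x \<in> W" "x \<notin> cfun.span B" by blast
  define y where "y = x - proj A B x"
  have p: "proj A B x \<in> cfun.span B"
    unfolding proj_def by (intro cfun.span_sum cfun.span_scale cfun.span_base)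
  then have "proj A B x \<in> W"
    using cfun.span_minimal[OF B(1) W(1)] by blast
  then have yW: "y \<in> W"
    unfolding y_def using W(1) x by (intro cfun.subspace_diff)
  have "y \<noteq> 0"
    using p x unfolding y_def by auto
  then have ny: "norm_sq A y > 0"
    using norm_sq_eq_0_iff[OF A, of y] yW W(2) norm_sq_nonneg[of A y] by force
  define e where "e = cscale (of_real (1 / sqrt (norm_sq A y))) y"
  have eW: "e \<in> W"
    unfolding e_def using W(1) yW by (rule cfun.subspace_scale)
  have "norm_sq A e = 1"
    unfolding e_def norm_sq_scale using ny by (simp add: norm_divide power_divide)
  then have ee: "herm A e e = 1"
    by (simp add: herm_self)
  have eb: "herm A e b = 0" if "b \<in> B" for b
    unfolding e_def y_def herm_scale_left herm_diff_left
    using herm_proj[OF B(2,4) that] by simp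
  then have be: "herm A b e = 0" if "b \<in> B" for b
    using that by (metis herm_commute complex_cnj_zero)
  have "e \<notin> B"
    using eb ee by force
  moreover have "orthonormal A (insert e B)"
    using B(4) ee eb be \<open>e \<notin> B\<close> by (auto simp: orthonormal_def)
  ultimately show ?case
    using B eW by (intro exI[of _ "insert e B"]) auto
qed

text \<open>A nonzero subrepresentation of least dimension inside \<open>M\<close> is irreducible: a
  nonzero subrepresentation of it cannot have smaller dimension, so it is the whole.\<close>

lemma irreducible_component_exists:
  assumes A: "finite A" and M: "subrepresentation G \<rho> (perm_space A) M" "M \<noteq> {0}"
  obtains W where "irreducible_component G \<rho> (perm_space A) W" "W \<subseteq> M"
proof -
  define P where "P W \<longleftrightarrow> subrepresentation G \<rho> (perm_space A) W \<and> W \<noteq> {0} \<and> W \<subseteq> M" for W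
  have "P M" using M by (simp add: P_def)
  then obtain W where W: "P W" and least: "\<And>U. P U \<Longrightarrow> cfun.dim W \<le> cfun.dim U"
    using arg_min_natI[of P M cfun.dim] arg_min_nat_le[of P _ cfun.dim] by blast
  have "U = {0} \<or> U = W" if U: "subrepresentation G \<rho> W U" for U
  proof (cases "U = {0}")
    case False
    have WU: "W \<subseteq> perm_space A" "cfun.subspace U" "U \<subseteq> W"
      using U W unfolding P_def subrepresentation_def by auto
    have "P U"
      using U W False WU unfolding P_def subrepresentation_def by auto
    then show ?thesis
      using subspace_eq_of_dim_le[OF A WU least] by simp
  qed simp
  then show thesis
    using that[of W] W unfolding irreducible_component_def P_def by blast
qed

text \<open>Functions carry the product topology. By Tychonoff the product of closed unit discs over
  \<open>A\<close> and of points \<open>0\<close> elsewhere is compact, and the two equations cut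
  out a closed subset of it.\<close>

lemma compact_unit_sphere:
  fixes A :: "'w set"
  assumes A: "finite A"
  shows "compact {v \<in> perm_space A. (\<Sum>x\<in>A. v x) = 0 \<and> norm_sq A v = 1}"
proof -
  let ?K = "PiE UNIV (\<lambda>x. if x \<in> A then cball (0::complex) 1 else {0})"
  have "compactin (product_topology (\<lambda>_. euclidean) UNIV) ?K"
    by (subst compactin_PiE) auto
  then have K: "compact ?K"
    by (simp add: euclidean_product_topology)
  have S: "closed {v :: 'w \<Rightarrow> complex. (\<Sum>x\<in>A. v x) = 0}"
    by (intro closed_Collect_eq continuous_intros continuous_on_product_coordinates)
  have N: "closed {v :: 'w \<Rightarrow> complex. norm_sq A v = 1}"
    unfolding norm_sq_def
    by (intro closed_Collect_eq continuous_intros continuous_on_product_coordinates)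
  have "cmod (v x) \<le> 1" if "norm_sq A v = 1" "x \<in> A" for v x
  proof -
    have "(cmod (v x))\<^sup>2 \<le> norm_sq A v"
      unfolding norm_sq_def using A that by (intro member_le_sum) auto
    then show ?thesis
      using that by (simp add: power_le_one_iff abs_square_le_1)
  qed
  then have "{v \<in> perm_space A. (\<Sum>x\<in>A. v x) = 0 \<and> norm_sq A v = 1}
    = ?K \<inter> ({v. (\<Sum>x\<in>A. v x) = 0} \<inter> {v. norm_sq A v = 1})"
    using A by (auto simp: mem_perm_space_iff PiE_iff split: if_splits)
  then show ?thesis
    using K S N by (simp add: compact_Int_closed closed_Int)
qed

section \<open>Averages of squared matrix coefficients\<close>

locale finite_transitive_action = transitive_action G E \<phi>
  for G (structure) and E :: "'w set" and \<phi> +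
  assumes finite_carrier: "finite (carrier G)" and finite_points: "finite E"
begin

sublocale group G
  using group_hom group_hom.axioms(1) by blast

abbreviation \<rho> where "\<rho> \<equiv> perm_rep E \<phi>"

section \<open>Unitarity of the permutation representation\<close>

lemma action_mem: "g \<in> carrier G \<Longrightarrow> x \<in> E \<Longrightarrow> \<phi> g x \<in> E"
  using element_image by blast

lemma bij_betw_action: "g \<in> carrier G \<Longrightarrow> bij_betw (\<phi> g) E E"
  by (simp add: bij_betw_def inj_prop surj_prop)

lemma perm_rep_eval: "\<rho> g v y = (\<Sum>x\<in>E. if \<phi> g x = y then v x else 0)"
  unfolding perm_rep_def sum_fun_eval by (intro sum.cong) (auto simp: cscale_def basis_vec_def)

lemma perm_rep_action:
  assumes "g \<in> carrier G" "x \<in> E"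
  shows "\<rho> g v (\<phi> g x) = v x"
proof -
  have "\<rho> g v (\<phi> g x) = (\<Sum>x'\<in>E. if x' = x then v x' else 0)"
    unfolding perm_rep_eval using assms inj_prop[of g] by (intro sum.cong) (auto dest: inj_onD)
  then show ?thesis
    using assms finite_points by simp
qed

lemma perm_rep_mem:
  assumes "g \<in> carrier G"
  shows "\<rho> g v \<in> perm_space E"
  using assms action_mem finite_points
  by (auto simp: mem_perm_space_iff perm_rep_eval intro!: sum.neutral)

text \<open>Moving basis vectors by \<open>g\<close> translates coefficient functions by
  \<open>inv g\<close>, which is the form that occurs in the convolution.\<close>

lemma perm_rep_apply:
  assumes "g \<in> carrier G" "y \<in> E"
  shows "\<rho> g v y = v (\<phi> (inv g) y)"
proof -
  obtain x where x: "x \<in> E" "\<phi> g x = y"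
    using bij_prop1[OF assms] by blast
  then show ?thesis
    using perm_rep_action[OF assms(1) x(1)] orbit_sym_aux[OF assms(1) x] by simp
qed

lemma perm_rep_add: "\<rho> g (v + w) = \<rho> g v + \<rho> g w"
  by (rule ext) (auto simp: perm_rep_eval simp flip: sum.distrib intro!: sum.cong)

lemma perm_rep_diff: "\<rho> g (v - w) = \<rho> g v - \<rho> g w"
  by (rule ext) (auto simp: perm_rep_eval simp flip: sum_subtractf intro!: sum.cong)

lemma perm_rep_scale: "\<rho> g (cscale a v) = cscale a (\<rho> g v)"
  by (rule ext) (auto simp: perm_rep_eval cscale_def sum_distrib_left intro!: sum.cong)

lemma perm_rep_mult:
  assumes "g \<in> carrier G" "h \<in> carrier G"
  shows "\<rho> (g \<otimes> h) v = \<rho> g (\<rho> h v)"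
proof
  fix y
  show "\<rho> (g \<otimes> h) v y = \<rho> g (\<rho> h v) y"
  proof (cases "y \<in> E")
    case True
    then show ?thesis
      using assms by (simp add: perm_rep_apply action_mem inv_mult_group composition_rule)
  next
    case False
    then show ?thesis
      using assms perm_rep_mem finite_points by (metis m_closed mem_perm_space_iff)
  qed
qed

lemma sum_perm_rep:
  assumes "g \<in> carrier G"
  shows "(\<Sum>x\<in>E. \<rho> g v x) = (\<Sum>x\<in>E. v x)"
  using sum.reindex_bij_betw[OF bij_betw_action[OF assms], of "\<rho> g v"] assms
  by (simp add: perm_rep_action)

lemma norm_sq_perm_rep:
  assumes "g \<in> carrier G"
  shows "norm_sq E (\<rho> g v) = norm_sq E v"
  using sum.reindex_bij_betw[OF bij_betw_action[OF assms], of "\<lambda>x. (cmod (\<rho> g v x))\<^sup>2"] assms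
  by (simp add: perm_rep_action norm_sq_def)

text \<open>Reindexing along the permutation \<open>\<phi> g\<close> shows that the adjoint of
  \<open>g\<close> is its inverse. This lets the group element pass from the members of an
  orthonormal family to the fixed vector, where Bessel's inequality applies.\<close>

lemma herm_perm_rep:
  assumes "g \<in> carrier G"
  shows "herm E (\<rho> g v) u = herm E v (\<rho> (inv g) u)"
  using sum.reindex_bij_betw[OF bij_betw_action[OF assms], of "\<lambda>x. \<rho> g v x * cnj (u x)"] assms
  by (simp add: perm_rep_action herm_def perm_rep_apply)

section \<open>The quadratic form of squared matrix coefficients\<close>

definition coeff_sum :: "('w \<Rightarrow> complex) \<Rightarrow> ('w \<Rightarrow> complex) \<Rightarrow> real"
  where "coeff_sum u w = (\<Sum>g\<in>carrier G. (cmod (herm E (\<rho> g w) u))\<^sup>2)"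

text \<open>Right multiplication by \<open>h\<close> only permutes the summands. Hence the extremal
  vectors of the form are carried to extremal vectors by the group.\<close>

lemma coeff_sum_perm_rep:
  assumes "h \<in> carrier G"
  shows "coeff_sum u (\<rho> h w) = coeff_sum u w"
proof -
  have "coeff_sum u (\<rho> h w) = (\<Sum>g\<in>carrier G. (cmod (herm E (\<rho> (g \<otimes> h) w) u))\<^sup>2)"
    unfolding coeff_sum_def using assms by (simp add: perm_rep_mult)
  also have "\<dots> = coeff_sum u w"
    unfolding coeff_sum_def
    by (rule sum.reindex_bij_witness[of _ "\<lambda>g. g \<otimes> inv h" "\<lambda>g. g \<otimes> h"])
      (use assms in \<open>auto simp: m_assoc\<close>)
  finally show ?thesis .
qed

lemma coeff_sum_scale: "coeff_sum u (cscale a w) = (cmod a)\<^sup>2 * coeff_sum u w"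
  by (simp add: coeff_sum_def perm_rep_scale herm_scale_left norm_mult power_mult_distrib
      sum_distrib_left)

lemma coeff_sum_parallelogram:
  "coeff_sum u (v + w) + coeff_sum u (v - w) = 2 * coeff_sum u v + 2 * coeff_sum u w"
  by (simp add: coeff_sum_def sum_distrib_left perm_rep_add perm_rep_diff herm_add_left
      herm_diff_left cmod_parallelogram flip: sum.distrib)

lemma sum_coeff_sum_le:
  assumes "finite B" "orthonormal E B"
  shows "(\<Sum>b\<in>B. coeff_sum u b) \<le> order G * norm_sq E u"
proof -
  have "(\<Sum>b\<in>B. coeff_sum u b) =
      (\<Sum>g\<in>carrier G. \<Sum>b\<in>B. (cmod (herm E (\<rho> (inv g) u) b))\<^sup>2)"
    unfolding coeff_sum_def
  proof (subst sum.swap, intro sum.cong refl)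
    fix g b assume "g \<in> carrier G"
    then show "(cmod (herm E (\<rho> g b) u))\<^sup>2 = (cmod (herm E (\<rho> (inv g) u) b))\<^sup>2"
      by (metis herm_perm_rep herm_commute complex_mod_cnj)
  qed
  also have "\<dots> \<le> (\<Sum>g\<in>carrier G. norm_sq E (\<rho> (inv g) u))"
    by (intro sum_mono bessel assms)
  also have "\<dots> = order G * norm_sq E u"
    by (simp add: norm_sq_perm_rep order_def)
  finally show ?thesis .
qed

text \<open>By transitivity an invariant vector is constant on \<open>E\<close>, so its coordinate
  sum is \<open>card E\<close> times that constant.\<close>

lemma invariant_mean_zero:
  assumes v: "v \<in> perm_space E" "(\<Sum>x\<in>E. v x) = 0" and inv: "\<And>g. g \<in> carrier G \<Longrightarrow> \<rho> g v = v"
  shows "v = 0"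
proof (rule ext)
  fix x
  show "v x = 0 x"
  proof (cases "x \<in> E")
    case True
    have "v y = v x" if "y \<in> E" for y
      using unique_orbit[OF True that] perm_rep_action[OF _ True, of _ v] inv by metis
    then have "(\<Sum>y\<in>E. v y) = of_nat (card E) * v x"
      by simp
    then show ?thesis
      using v(2) True finite_points by auto
  next
    case False
    then show ?thesis
      using v(1) finite_points by (simp add: mem_perm_space_iff)
  qed
qed

lemma coeff_sum_le:
  assumes w: "w \<in> perm_space E" "(\<Sum>x\<in>E. w x) = 0"
  shows "min_nontrivial_dim G E \<phi> * coeff_sum u w \<le> order G * norm_sq E u * norm_sq E w"
\<comment> \<open>A nonzero \<open>w\<close> provides, after scaling, a point of the unit sphere
  \<open>K\<close>, on which a maximum is then sought; for a one-point \<open>E\<close> that sphere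
  is empty.\<close>
proof (cases "w = 0")
  case True
  then show ?thesis
    using coeff_sum_scale[of u 0 w] norm_sq_scale[of E 0 w] by (simp add: cscale_def zero_fun_def)
next
  case False
  define V where "V = {v \<in> perm_space E. (\<Sum>x\<in>E. v x) = 0}"
  define K where "K = {v \<in> perm_space E. (\<Sum>x\<in>E. v x) = 0 \<and> norm_sq E v = 1}"
  have V: "cfun.subspace V"
    using subspace_perm_space[of E]
    by (auto simp: V_def cfun.subspace_def cscale_def sum.distrib simp flip: sum_distrib_left)
  define normalize where "normalize v = cscale (of_real (1 / sqrt (norm_sq E v))) v" for v
  have pos: "norm_sq E v > 0" if "v \<in> V" "v \<noteq> 0" for v
    using norm_sq_eq_0_iff[OF finite_points, of v] that norm_sq_nonneg[of E v]
    by (force simp: V_def)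
  have normalize: "normalize v \<in> K" "coeff_sum u v = norm_sq E v * coeff_sum u (normalize v)"
    if "v \<in> V" "v \<noteq> 0" for v
  proof -
    have "normalize v \<in> V"
      unfolding normalize_def using V that(1) by (rule cfun.subspace_scale)
    then show "normalize v \<in> K" "coeff_sum u v = norm_sq E v * coeff_sum u (normalize v)"
      using pos[OF that]
      by (auto simp: V_def K_def normalize_def norm_sq_scale coeff_sum_scale norm_divide power_divide)
  qed
  have "w \<in> V" using w by (simp add: V_def)
  \<comment> \<open>Written out in coordinates, the form is visibly continuous for the product
    topology.\<close>
  have "coeff_sum u = (\<lambda>v. \<Sum>g\<in>carrier G. (cmod (\<Sum>x\<in>E. v (\<phi> (inv g) x) * cnj (u x)))\<^sup>2)"
    by (simp add: fun_eq_iff coeff_sum_def herm_def perm_rep_apply)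
  then have "continuous_on K (coeff_sum u)"
    by (auto intro!: continuous_intros intro: continuous_on_subset[OF continuous_on_product_coordinates])
  moreover have "compact K"
    unfolding K_def using finite_points by (rule compact_unit_sphere)
  moreover have "K \<noteq> {}"
    using normalize(1)[OF \<open>w \<in> V\<close> False] by blast
  ultimately obtain m where m: "m \<in> K" and max: "\<And>v. v \<in> K \<Longrightarrow> coeff_sum u v \<le> coeff_sum u m"
    using continuous_attains_sup by metis
  define l where "l = coeff_sum u m"
  have le: "coeff_sum u v \<le> l * norm_sq E v" if "v \<in> V" for v
  proof (cases "v = 0")
    case True
    then show ?thesis
      using coeff_sum_scale[of u 0 v] norm_sq_scale[of E 0 v] by (simp add: cscale_def zero_fun_def)
  next
    case False
    show ?thesis
      using normalize[OF that False] max norm_sq_nonneg[of E v]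
      by (simp add: l_def mult.commute mult_left_mono)
  qed
  define M where "M = {v \<in> V. coeff_sum u v = l * norm_sq E v}"
  have "cfun.subspace M"
  proof (rule cfun.subspaceI)
    show "0 \<in> M"
      using coeff_sum_scale[of u 0 0] norm_sq_scale[of E 0 0] cfun.subspace_0[OF V]
      by (simp add: M_def cscale_def zero_fun_def)
    show "cscale a v \<in> M" if "v \<in> M" for a v
      using that cfun.subspace_scale[OF V] by (simp add: M_def coeff_sum_scale norm_sq_scale)
    show "v + v' \<in> M" if "v \<in> M" "v' \<in> M" for v v'
    proof -
      have "v + v' \<in> V" "v - v' \<in> V"
        using that cfun.subspace_add[OF V] cfun.subspace_diff[OF V] by (auto simp: M_def)
      \<comment> \<open>The defect \<open>l * norm_sq E x - coeff_sum u x\<close> is nonnegative on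
        \<open>V\<close>. By the parallelogram law its values at \<open>v + v'\<close> and
        \<open>v - v'\<close> add up to zero, so both vanish.\<close>
      moreover have "coeff_sum u (v + v') + coeff_sum u (v - v') =
          l * norm_sq E (v + v') + l * norm_sq E (v - v')"
        unfolding distrib_left[symmetric] coeff_sum_parallelogram norm_sq_parallelogram
        using that by (simp add: M_def distrib_left)
      ultimately show ?thesis
        using le[of "v + v'"] le[of "v - v'"] by (simp add: M_def)
    qed
  qed
  moreover have "\<rho> g v \<in> M" if "g \<in> carrier G" "v \<in> M" for g v
    using that by (simp add: M_def V_def perm_rep_mem sum_perm_rep norm_sq_perm_rep coeff_sum_perm_rep)
  ultimately have "subrepresentation G \<rho> (perm_space E) M"
    by (auto simp: subrepresentation_def M_def V_def)
  moreover have "m \<in> M"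
    using m by (simp add: M_def V_def K_def l_def)
  moreover have "m \<noteq> 0"
    using m by (auto simp: K_def norm_sq_def)
  ultimately obtain W where W: "irreducible_component G \<rho> (perm_space E) W" "W \<subseteq> M"
    using irreducible_component_exists[OF finite_points, of G \<rho> M] by blast
  have "\<not> trivial_on G \<rho> W"
  proof
    assume "trivial_on G \<rho> W"
    then have "v = 0" if "v \<in> W" for v
      using that W(2) by (intro invariant_mean_zero) (auto simp: trivial_on_def M_def V_def)
    moreover have "0 \<in> W" "W \<noteq> {0}"
      using W(1) cfun.subspace_0 by (auto simp: irreducible_component_def subrepresentation_def)
    ultimately show False by blast
  qed
  then have D: "min_nontrivial_dim G E \<phi> \<le> cfun.dim W"
    unfolding min_nontrivial_dim_def using W(1) by (intro Least_le) blast
  obtain B where B: "B \<subseteq> W" "finite B" "card B = min_nontrivial_dim G E \<phi>" "orthonormal E B"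
    using orthonormal_subset_exists[OF finite_points _ _ D] W(1)
    by (auto simp: irreducible_component_def subrepresentation_def)
  have "coeff_sum u b = l" if "b \<in> B" for b
  proof -
    have "complex_of_real (norm_sq E b) = 1"
      using B(4) that by (simp add: orthonormal_def flip: herm_self)
    then show ?thesis
      using that B(1) W(2) by (auto simp: M_def)
  qed
  then have *: "min_nontrivial_dim G E \<phi> * l \<le> order G * norm_sq E u"
    using sum_coeff_sum_le[OF B(2,4), of u] B(3) by simp
  have "min_nontrivial_dim G E \<phi> * coeff_sum u w \<le> min_nontrivial_dim G E \<phi> * (l * norm_sq E w)"
    using le[OF \<open>w \<in> V\<close>] by (intro mult_left_mono) auto
  also have "\<dots> \<le> order G * norm_sq E u * norm_sq E w"
    using mult_right_mono[OF * norm_sq_nonneg[of E w]] by (simp add: mult.assoc)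
  finally show ?thesis .
qed

section \<open>From matrix coefficients to the convolution\<close>

lemma L2_set_convolution_le:
  assumes f: "(\<Sum>x\<in>E. f x) = 0"
  shows "min_nontrivial_dim G E \<phi> * (L2_set (convolution G \<phi> \<mu> f) E)\<^sup>2
    \<le> order G * (L2_set \<mu> (carrier G))\<^sup>2 * (L2_set f E)\<^sup>2"
proof -
  define h where "h = convolution G \<phi> \<mu> f"
  define u where "u = (\<lambda>x. complex_of_real (h x))"
  \<comment> \<open>The values of \<open>f\<close> outside \<open>E\<close> are arbitrary, whereas
    members of \<open>perm_space E\<close> vanish there. No such cut-off is made for
    \<open>u\<close>, which enters only through its values on \<open>E\<close>.\<close>
  define w where "w = (\<lambda>x. if x \<in> E then complex_of_real (f x) else 0)"
  define a where "a g = (\<Sum>x\<in>E. f (\<phi> (inv g) x) * h x)" for g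
  define N where "N = (L2_set h E)\<^sup>2"
  have N: "norm_sq E u = N" "norm_sq E w = (L2_set f E)\<^sup>2"
    by (auto simp: N_def norm_sq_def u_def w_def L2_set_def sum_nonneg)
  have "N \<ge> 0" by (simp add: N_def)
  have w: "w \<in> perm_space E" "(\<Sum>x\<in>E. w x) = 0"
    using f finite_points by (auto simp: mem_perm_space_iff w_def simp flip: of_real_sum)
  have "herm E (\<rho> g w) u = of_real (a g)" if "g \<in> carrier G" for g
    using that by (simp add: herm_def perm_rep_apply a_def u_def w_def action_mem)
  then have Q: "coeff_sum u w = (\<Sum>g\<in>carrier G. (a g)\<^sup>2)"
    by (simp add: coeff_sum_def)
  \<comment> \<open>One of the two factors \<open>h x\<close> in the squared norm is expanded as a
    convolution, so that \<open>N\<close> becomes a sum of matrix coefficients weighted by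
    \<open>\<mu>\<close>.\<close>
  have "N = (\<Sum>x\<in>E. \<Sum>g\<in>carrier G. \<mu> g * (f (\<phi> (inv g) x) * h x))"
    by (simp add: N_def L2_set_def sum_nonneg power2_eq_square[of "h _"])
      (simp add: h_def convolution_def sum_distrib_right mult.assoc)
  also have "\<dots> = (\<Sum>g\<in>carrier G. \<mu> g * a g)"
    by (subst sum.swap) (simp add: a_def sum_distrib_left)
  finally have "N\<^sup>2 \<le> (\<Sum>g\<in>carrier G. (\<mu> g)\<^sup>2) * coeff_sum u w"
    unfolding Q using Cauchy_Schwarz_ineq_sum by metis
  then have "min_nontrivial_dim G E \<phi> * N\<^sup>2
      \<le> (L2_set \<mu> (carrier G))\<^sup>2 * (min_nontrivial_dim G E \<phi> * coeff_sum u w)"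
    using mult_left_mono[of "N\<^sup>2" _ "real (min_nontrivial_dim G E \<phi>)"]
    by (simp add: L2_set_def sum_nonneg mult.left_commute)
  also have "\<dots> \<le> (L2_set \<mu> (carrier G))\<^sup>2 * (order G * N * (L2_set f E)\<^sup>2)"
    using coeff_sum_le[OF w, of u] by (intro mult_left_mono) (simp_all add: N)
  finally have *: "(min_nontrivial_dim G E \<phi> * N) * N
      \<le> (order G * (L2_set \<mu> (carrier G))\<^sup>2 * (L2_set f E)\<^sup>2) * N"
    by (simp add: power2_eq_square algebra_simps)
  show ?thesis
  \<comment> \<open>The Cauchy-Schwarz bound is quadratic in \<open>N\<close>; one factor is
    cancelled when \<open>N\<close> is positive.\<close>
  proof (cases "N = 0")
    case True
    then show ?thesis
      by (simp add: N_def h_def)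
  next
    case False
    then show ?thesis
      using \<open>N \<ge> 0\<close> mult_right_le_imp_le[OF *] by (simp add: N_def h_def)
  qed
qed

end

section \<open>The bound for the family of Schreier graphs\<close>

theorem corollary1p5:
  fixes c :: real
    and G :: "nat \<Rightarrow> 'g monoid"
    and \<Omega> :: "nat \<Rightarrow> 'w set"
    and \<phi> :: "nat \<Rightarrow> 'g \<Rightarrow> 'w \<Rightarrow> 'w"
    and S :: "nat \<Rightarrow> 'g set"
    and X :: "nat \<Rightarrow> 'w pair_pre_digraph"
  assumes "c > 0"
    and "\<And>n. X n = Sch (G n) (\<Omega> n) (\<phi> n) (S n)"
    and "\<And>n. finite (carrier (G n))"
    and "\<And>n. transitive_action (G n) (\<Omega> n) (\<phi> n)"
    and "\<And>n. finite (\<Omega> n)"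
    and "\<And>n. card (\<Omega> n) \<ge> 2"
    and "\<And>n. S n \<subseteq> carrier (G n)"
    and "\<And>n. real (min_nontrivial_dim (G n) (\<Omega> n) (\<phi> n)) \<ge> real (order (G n)) powr c"
  shows "\<forall>n (\<mu> :: 'g \<Rightarrow> real) (f :: 'w \<Rightarrow> real).
    prob_distribution (carrier (G n)) \<mu> \<longrightarrow> (\<Sum>x\<in>\<Omega> n. f x) = 0 \<longrightarrow>
    (L2_set (convolution (G n) (\<phi> n) \<mu> f) (\<Omega> n))\<^sup>2
      \<le> real (order (G n)) powr (1 - c) * (L2_set \<mu> (carrier (G n)))\<^sup>2 * (L2_set f (\<Omega> n))\<^sup>2"
proof (intro allI impI)
  fix n and \<mu> :: "'g \<Rightarrow> real" and f :: "'w \<Rightarrow> real"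
  assume f: "(\<Sum>x\<in>\<Omega> n. f x) = 0"
  interpret finite_transitive_action "G n" "\<Omega> n" "\<phi> n"
    using assms by (simp add: finite_transitive_action_def finite_transitive_action_axioms_def)
  define d where "d = real (order (G n)) powr c"
  let ?C = "(L2_set (convolution (G n) (\<phi> n) \<mu> f) (\<Omega> n))\<^sup>2"
  let ?R = "(L2_set \<mu> (carrier (G n)))\<^sup>2 * (L2_set f (\<Omega> n))\<^sup>2"
  have o: "real (order (G n)) > 0"
    using finite_carrier by (simp add: order_gt_0_iff_finite)
  have "d * ?C \<le> real (min_nontrivial_dim (G n) (\<Omega> n) (\<phi> n)) * ?C"
    unfolding d_def using assms(8) by (intro mult_right_mono) auto
  also have "\<dots> \<le> order (G n) * ?R"
    using L2_set_convolution_le[OF f, of \<mu>] by (simp add: mult.assoc)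
  \<comment> \<open>A group has positive order, so \<open>d\<close> is positive and may be divided
    out; the quotient of the order by \<open>d\<close> is the power with exponent
    \<open>1 - c\<close>.\<close>
  finally have "?C \<le> order (G n) * ?R / d"
    using o by (subst pos_le_divide_eq) (simp_all add: d_def mult.commute)
  also have "\<dots> = real (order (G n)) powr (1 - c) * ?R"
    using o by (simp add: d_def powr_diff)
  finally show "?C \<le> real (order (G n)) powr (1 - c) * (L2_set \<mu> (carrier (G n)))\<^sup>2 * (L2_set f (\<Omega> n))\<^sup>2"
    by (simp only: mult.assoc)
qed

end
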